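(* (i) A weak bialgebra $A$ has at most one antipode. If $A$ has a pre-antipode $S_p$, then $\varepsilon_{LR}*\varepsilon_{LR}=\varepsilon_{LR}$, $\varepsilon_{RL}*\varepsilon_{RL}=\varepsilon_{RL}$, and $S:=S_p*\mathrm{id}_A*S_p$ is an antipode. (ii) Let $S$ be a pre-antipode on a weak bialgebra $A$. If $S$ is anti-multiplicative, then $S(1)=1$; if $S$ is anti-comultiplicative, then $\varepsilon\circ S=\varepsilon$.
   Context: $K$ is a field and all spaces are finite dimensional over $K$. A weak bialgebra $(A,1,\Delta,\varepsilon)$ is a unital associative $K$-algebra $(A,1)$ which is also a coassociative coalgebra with coproduct $\Delta$ and counit $\varepsilon$, such that $\Delta(ab)=\Delta(a)\Delta(b)$ for all $a,b$; neither $\Delta(1)=1\otimes1$ nor multiplicativity of $\varepsilon$ is required. Sweedler notation is used. Put $\varepsilon_{LR}(a)=\varepsilon(1_{(1)}a)1_{(2)}$ and $\varepsilon_{RL}(a)=1_{(1)}\varepsilon(a1_{(2)})$. For $S,T\in\mathrm{End}_KA$, the convolution product is $(S*T)(a)=S(a_{(1)})T(a_{(2)})$. A pre-antipode on $A$ is a linear map $S:A\to A$ with $a_{(1)}S(a_{(2)})=\varepsilon_{LR}(a)$ and $S(a_{(1)})a_{(2)}=\varepsilon_{RL}(a)$ for all $a\in A$. A pre-antipode is called an antipode if in addition $S(a_{(1)})a_{(2)}S(a_{(3)})=S(a)$ for all $a\in A$. $S$ is anti-multiplicative if $S(ab)=S(b)S(a)$ for all $a,b$, and anti-comultiplicative if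 $\Delta(S(a))=S(a_{(2)})\otimes S(a_{(1)})$ for all $a$. *)

theory Defs
  imports Complex_Main "HOL-Library.Poly_Mapping"
begin

section \<open>Free vector spaces and tensor powers\<close>

text \<open>
  The free vector space over a field on the points of a type \<open>'x\<close> is the type of finitely
  supported functions \<open>'x \<Rightarrow>\<^sub>0 'k\<close>. A tensor power of a vector space is
  constructed as the quotient of the free vector space on the tuples by the subspace generated by
  the linearity relations in each slot. Since the relations depend on the scalar multiplication of
  the given space, the elements of the quotient are represented as cosets.
\<close>

definition free_scale :: "'k::field \<Rightarrow> ('x \<Rightarrow>\<^sub>0 'k) \<Rightarrow> ('x \<Rightarrow>\<^sub>0 'k)" where
  "free_scale c p = Poly_Mapping.map ((*) c) p"

definition point :: "'x \<Rightarrow> ('x \<Rightarrow>\<^sub>0 'k::field)" where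
  "point x = Poly_Mapping.single x 1"

text \<open>The linear extension of a map from the basis to a vector space with scalar
  multiplication \<open>sv\<close>.\<close>

definition free_extend ::
    "('k::field \<Rightarrow> 'v \<Rightarrow> 'v::ab_group_add) \<Rightarrow> ('x \<Rightarrow> 'v) \<Rightarrow> ('x \<Rightarrow>\<^sub>0 'k) \<Rightarrow> 'v" where
  "free_extend sv f p = (\<Sum>x\<in>Poly_Mapping.keys p. sv (Poly_Mapping.lookup p x) (f x))"

text \<open>A slot is a map that inserts a vector at one position of a tuple whose other entries are
  fixed.\<close>

definition slots2 :: "('a \<Rightarrow> 'a \<times> 'a) set" where
  "slots2 = {\<lambda>u. (u, y) | y. True} \<union> {\<lambda>u. (x, u) | x. True}"

definition slots3 :: "('a \<Rightarrow> 'a \<times> 'a \<times> 'a) set" where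
  "slots3 = {\<lambda>u. (u, y, z) | y z. True} \<union> {\<lambda>u. (x, u, z) | x z. True} \<union> {\<lambda>u. (x, y, u) | x y. True}"

definition linearity_relations ::
    "('k::field \<Rightarrow> 'a \<Rightarrow> 'a::ab_group_add) \<Rightarrow> ('a \<Rightarrow> 'x) set \<Rightarrow> ('x \<Rightarrow>\<^sub>0 'k) set" where
  "linearity_relations scale slots =
     {point (s (u + v)) - point (s u) - point (s v) | s u v. s \<in> slots} \<union>
     {point (s (scale c u)) - free_scale c (point (s u)) | s c u. s \<in> slots}"

definition tensor_class ::
    "('k::field \<Rightarrow> 'a \<Rightarrow> 'a::ab_group_add) \<Rightarrow> ('a \<Rightarrow> 'x) set \<Rightarrow> ('x \<Rightarrow>\<^sub>0 'k) \<Rightarrow> ('x \<Rightarrow>\<^sub>0 'k) set" where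
  "tensor_class scale slots p =
     {q. q - p \<in> module.span free_scale (linearity_relations scale slots)}"

type_synonym ('a, 'k) tensor2 = "('a \<times> 'a \<Rightarrow>\<^sub>0 'k) set"
type_synonym ('a, 'k) tensor3 = "('a \<times> 'a \<times> 'a \<Rightarrow>\<^sub>0 'k) set"

definition class2 ::
    "('k::field \<Rightarrow> 'a \<Rightarrow> 'a::ab_group_add) \<Rightarrow> ('a \<times> 'a \<Rightarrow>\<^sub>0 'k) \<Rightarrow> ('a, 'k) tensor2" where
  "class2 scale = tensor_class scale slots2"

definition class3 ::
    "('k::field \<Rightarrow> 'a \<Rightarrow> 'a::ab_group_add) \<Rightarrow> ('a \<times> 'a \<times> 'a \<Rightarrow>\<^sub>0 'k) \<Rightarrow> ('a, 'k) tensor3" where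
  "class3 scale = tensor_class scale slots3"

definition tensor2_space :: "('k::field \<Rightarrow> 'a \<Rightarrow> 'a::ab_group_add) \<Rightarrow> ('a, 'k) tensor2 set" where
  "tensor2_space scale = range (class2 scale)"

text \<open>
  Sweedler notation: a finite sum \<open>\<Sum> x \<otimes> y\<close> representing the tensor \<open>t\<close> is chosen, and
  \<open>sweedler sv f t\<close> is the corresponding sum of the vectors \<open>f x y\<close>. For bilinear \<open>f\<close> this is the
  value at \<open>t\<close> of the linear map induced by \<open>f\<close>, whatever the choice (see \<open>sweedler_class2\<close> below).
  When \<open>f\<close> takes values in a free vector space and is bilinear only modulo the linearity relations,
  the class of the sum is independent of the choice.
\<close>

definition representative :: "('x \<Rightarrow>\<^sub>0 'k::field) set \<Rightarrow> ('x \<Rightarrow>\<^sub>0 'k)" where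
  "representative t = (SOME p. p \<in> t)"

definition sweedler ::
    "('k::field \<Rightarrow> 'v \<Rightarrow> 'v::ab_group_add) \<Rightarrow> ('a \<Rightarrow> 'a \<Rightarrow> 'v) \<Rightarrow> ('a, 'k) tensor2 \<Rightarrow> 'v" where
  "sweedler sv f t = free_extend sv (\<lambda>(x, y). f x y) (representative t)"

definition tensor2_add ::
    "('k::field \<Rightarrow> 'a \<Rightarrow> 'a::ab_group_add) \<Rightarrow> ('a, 'k) tensor2 \<Rightarrow> ('a, 'k) tensor2 \<Rightarrow> ('a, 'k) tensor2" where
  "tensor2_add scale s t = class2 scale (representative s + representative t)"

definition tensor2_scale ::
    "('k::field \<Rightarrow> 'a \<Rightarrow> 'a::ab_group_add) \<Rightarrow> 'k \<Rightarrow> ('a, 'k) tensor2 \<Rightarrow> ('a, 'k) tensor2" where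
  "tensor2_scale scale c t = class2 scale (free_scale c (representative t))"

text \<open>The product \<open>(x \<otimes> y)(x' \<otimes> y') = xx' \<otimes> yy'\<close>.\<close>

definition tensor2_mult ::
    "('k::field \<Rightarrow> 'a \<Rightarrow> 'a::ring) \<Rightarrow> ('a, 'k) tensor2 \<Rightarrow> ('a, 'k) tensor2 \<Rightarrow> ('a, 'k) tensor2" where
  "tensor2_mult scale s t = class2 scale
     (sweedler free_scale (\<lambda>x y. sweedler free_scale (\<lambda>x' y'. point (x * x', y * y')) t) s)"


section \<open>Weak bialgebras\<close>

text \<open>
  The sort \<open>{ring, monoid_mult}\<close> describes unital rings in which \<open>0 = 1\<close> is allowed, so that the
  zero algebra is not excluded.
\<close>

locale fin_dim_algebra =
  fixes scale :: "'k::field \<Rightarrow> 'a::{ring, monoid_mult} \<Rightarrow> 'a"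
  assumes finite_dimensional: "\<exists>B. finite_dimensional_vector_space scale B"
    and scale_mult_left: "scale c a * b = scale c (a * b)"
    and scale_mult_right: "a * scale c b = scale c (a * b)"

locale coalgebra =
  fixes scale :: "'k::field \<Rightarrow> 'a::ab_group_add \<Rightarrow> 'a"
    and \<Delta> :: "'a \<Rightarrow> ('a, 'k) tensor2"
    and \<epsilon> :: "'a \<Rightarrow> 'k"
  assumes vector_space: "vector_space scale"
    and comult_closed: "\<Delta> a \<in> tensor2_space scale"
    and comult_add: "\<Delta> (a + b) = tensor2_add scale (\<Delta> a) (\<Delta> b)"
    and comult_scale: "\<Delta> (scale c a) = tensor2_scale scale c (\<Delta> a)"
    and counit_linear: "Vector_Spaces.linear scale (*) \<epsilon>"
    \<comment> \<open>\<open>a\<^sub>1\<^sub>1 \<otimes> a\<^sub>1\<^sub>2 \<otimes> a\<^sub>2 = a\<^sub>1 \<otimes> a\<^sub>2\<^sub>1 \<otimes> a\<^sub>2\<^sub>2\<close>\<close>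
    and coassoc:
      "class3 scale (sweedler free_scale (\<lambda>x y. sweedler free_scale (\<lambda>u v. point (u, v, y)) (\<Delta> x)) (\<Delta> a)) =
       class3 scale (sweedler free_scale (\<lambda>x y. sweedler free_scale (\<lambda>u v. point (x, u, v)) (\<Delta> y)) (\<Delta> a))"
    and counit_left: "sweedler scale (\<lambda>x y. scale (\<epsilon> x) y) (\<Delta> a) = a"
    and counit_right: "sweedler scale (\<lambda>x y. scale (\<epsilon> y) x) (\<Delta> a) = a"

locale weak_bialgebra = fin_dim_algebra scale + coalgebra scale \<Delta> \<epsilon>
  for scale :: "'k::field \<Rightarrow> 'a::{ring, monoid_mult} \<Rightarrow> 'a"
    and \<Delta> :: "'a \<Rightarrow> ('a, 'k) tensor2"
    and \<epsilon> :: "'a \<Rightarrow> 'k" +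
  assumes comult_mult: "\<Delta> (a * b) = tensor2_mult scale (\<Delta> a) (\<Delta> b)"

definition eps_LR ::
    "('k::field \<Rightarrow> 'a \<Rightarrow> 'a::{ring, monoid_mult}) \<Rightarrow> ('a \<Rightarrow> ('a, 'k) tensor2) \<Rightarrow> ('a \<Rightarrow> 'k) \<Rightarrow> 'a \<Rightarrow> 'a" where
  "eps_LR scale \<Delta> \<epsilon> a = sweedler scale (\<lambda>x y. scale (\<epsilon> (x * a)) y) (\<Delta> 1)"

definition eps_RL ::
    "('k::field \<Rightarrow> 'a \<Rightarrow> 'a::{ring, monoid_mult}) \<Rightarrow> ('a \<Rightarrow> ('a, 'k) tensor2) \<Rightarrow> ('a \<Rightarrow> 'k) \<Rightarrow> 'a \<Rightarrow> 'a" where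
  "eps_RL scale \<Delta> \<epsilon> a = sweedler scale (\<lambda>x y. scale (\<epsilon> (a * y)) x) (\<Delta> 1)"

definition convolution ::
    "('k::field \<Rightarrow> 'a \<Rightarrow> 'a::ring) \<Rightarrow> ('a \<Rightarrow> ('a, 'k) tensor2) \<Rightarrow> ('a \<Rightarrow> 'a) \<Rightarrow> ('a \<Rightarrow> 'a) \<Rightarrow> 'a \<Rightarrow> 'a" where
  "convolution scale \<Delta> S T a = sweedler scale (\<lambda>x y. S x * T y) (\<Delta> a)"

definition pre_antipode ::
    "('k::field \<Rightarrow> 'a \<Rightarrow> 'a::{ring, monoid_mult}) \<Rightarrow> ('a \<Rightarrow> ('a, 'k) tensor2) \<Rightarrow> ('a \<Rightarrow> 'k) \<Rightarrow> ('a \<Rightarrow> 'a) \<Rightarrow> bool" where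
  "pre_antipode scale \<Delta> \<epsilon> S \<longleftrightarrow>
     Vector_Spaces.linear scale scale S \<and>
     (\<forall>a. sweedler scale (\<lambda>x y. x * S y) (\<Delta> a) = eps_LR scale \<Delta> \<epsilon> a) \<and>
     (\<forall>a. sweedler scale (\<lambda>x y. S x * y) (\<Delta> a) = eps_RL scale \<Delta> \<epsilon> a)"

text \<open>Threefold Sweedler indices are those of \<open>(\<Delta> \<otimes> id)(\<Delta>(a))\<close>.\<close>

definition antipode ::
    "('k::field \<Rightarrow> 'a \<Rightarrow> 'a::{ring, monoid_mult}) \<Rightarrow> ('a \<Rightarrow> ('a, 'k) tensor2) \<Rightarrow> ('a \<Rightarrow> 'k) \<Rightarrow> ('a \<Rightarrow> 'a) \<Rightarrow> bool" where
  "antipode scale \<Delta> \<epsilon> S \<longleftrightarrow>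
     pre_antipode scale \<Delta> \<epsilon> S \<and>
     (\<forall>a. sweedler scale (\<lambda>x y. sweedler scale (\<lambda>u v. S u * v * S y) (\<Delta> x)) (\<Delta> a) = S a)"

definition anti_multiplicative :: "('a::ring \<Rightarrow> 'a) \<Rightarrow> bool" where
  "anti_multiplicative S \<longleftrightarrow> (\<forall>a b. S (a * b) = S b * S a)"

definition anti_comultiplicative ::
    "('k::field \<Rightarrow> 'a \<Rightarrow> 'a::ab_group_add) \<Rightarrow> ('a \<Rightarrow> ('a, 'k) tensor2) \<Rightarrow> ('a \<Rightarrow> 'a) \<Rightarrow> bool" where
  "anti_comultiplicative scale \<Delta> S \<longleftrightarrow>
     (\<forall>a. \<Delta> (S a) = class2 scale (sweedler free_scale (\<lambda>x y. point (S y, S x)) (\<Delta> a)))"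


section \<open>Independence of the chosen representatives\<close>

lemma lookup_free_scale: "Poly_Mapping.lookup (free_scale c p) x = c * Poly_Mapping.lookup p x"
  by (simp add: free_scale_def map.rep_eq when_def)

lemma vector_space_free_scale: "vector_space (free_scale :: 'k::field \<Rightarrow> ('x \<Rightarrow>\<^sub>0 'k) \<Rightarrow> _)"
  by unfold_locales
    (auto intro!: poly_mapping_eqI simp: lookup_free_scale lookup_add algebra_simps)

lemma free_extend_superset:
  assumes "vector_space sv" "finite X" "Poly_Mapping.keys p \<subseteq> X"
  shows "free_extend sv f p = (\<Sum>x\<in>X. sv (Poly_Mapping.lookup p x) (f x))"
proof -
  interpret vector_space sv by fact
  show ?thesis
    unfolding free_extend_def
    by (rule sum.mono_neutral_left) (use assms in \<open>auto simp: in_keys_iff\<close>)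
qed

lemma free_extend_linear:
  fixes sv :: "'k::field \<Rightarrow> 'v::ab_group_add \<Rightarrow> 'v" and f :: "'x \<Rightarrow> 'v"
  assumes "vector_space sv"
  shows "Vector_Spaces.linear free_scale sv (free_extend sv f)"
proof -
  interpret V: vector_space sv by fact
  interpret F: vector_space free_scale by (rule vector_space_free_scale)
  show ?thesis
  proof
    fix p q :: "'x \<Rightarrow>\<^sub>0 'k"
    define X where "X = Poly_Mapping.keys p \<union> Poly_Mapping.keys q"
    have X: "finite X" "Poly_Mapping.keys p \<subseteq> X" "Poly_Mapping.keys q \<subseteq> X"
      "Poly_Mapping.keys (p + q) \<subseteq> X"
      using Poly_Mapping.keys_add[of p q] by (auto simp: X_def)
    show "free_extend sv f (p + q) = free_extend sv f p + free_extend sv f q"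
      by (simp add: free_extend_superset[OF assms X(1)] X lookup_add V.scale_left_distrib sum.distrib)
  next
    fix c and p :: "'x \<Rightarrow>\<^sub>0 'k"
    have "Poly_Mapping.keys (free_scale c p) \<subseteq> Poly_Mapping.keys p"
      by (auto simp: in_keys_iff lookup_free_scale)
    then show "free_extend sv f (free_scale c p) = sv c (free_extend sv f p)"
      by (simp add: free_extend_superset[OF assms, of "Poly_Mapping.keys p"] lookup_free_scale
          V.scale_sum_right)
  qed
qed

lemma free_extend_point:
  assumes "vector_space sv"
  shows "free_extend sv f (point x) = f x"
proof -
  interpret V: vector_space sv by fact
  show ?thesis by (simp add: free_extend_def point_def)
qed

lemma tensor_class_eq_iff:
  fixes scale :: "'k::field \<Rightarrow> 'a::ab_group_add \<Rightarrow> 'a" and p q :: "'x \<Rightarrow>\<^sub>0 'k"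
  shows "tensor_class scale slots p = tensor_class scale slots q \<longleftrightarrow>
     p - q \<in> module.span free_scale (linearity_relations scale slots)"
proof -
  interpret F: vector_space "free_scale :: 'k \<Rightarrow> ('x \<Rightarrow>\<^sub>0 'k) \<Rightarrow> _" by (rule vector_space_free_scale)
  let ?N = "F.span (linearity_relations scale slots)"
  have "r - p \<in> ?N \<longleftrightarrow> r - q \<in> ?N" if "p - q \<in> ?N" for r
    using F.span_add_eq[OF that, of "r - p"] F.span_add[OF _ that, of "r - p"]
      F.span_diff[OF _ that, of "r - q"] by auto
  moreover have "p - q \<in> ?N" if "tensor_class scale slots p = tensor_class scale slots q"
    using that F.span_zero[of "linearity_relations scale slots"] unfolding tensor_class_def
    by (metis (mono_tags, lifting) diff_self mem_Collect_eq)
  ultimately show ?thesis by (auto simp: tensor_class_def)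
qed

lemma representative_class2:
  fixes scale :: "'k::field \<Rightarrow> 'a::ab_group_add \<Rightarrow> 'a"
  shows "representative (class2 scale p) - p \<in> module.span free_scale (linearity_relations scale slots2)"
proof -
  interpret F: vector_space "free_scale :: 'k \<Rightarrow> ('a \<times> 'a \<Rightarrow>\<^sub>0 'k) \<Rightarrow> _"
    by (rule vector_space_free_scale)
  have "p \<in> class2 scale p" by (simp add: class2_def tensor_class_def F.span_zero)
  then have "representative (class2 scale p) \<in> class2 scale p"
    unfolding representative_def by (rule someI)
  then show ?thesis by (simp add: class2_def tensor_class_def)
qed

theorem sweedler_class2:
  fixes scale :: "'k::field \<Rightarrow> 'a::ab_group_add \<Rightarrow> 'a"
    and sv :: "'k \<Rightarrow> 'v::ab_group_add \<Rightarrow> 'v"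
  assumes sv: "vector_space sv"
    and 1: "\<And>y. Vector_Spaces.linear scale sv (\<lambda>x. f x y)"
    and 2: "\<And>x. Vector_Spaces.linear scale sv (\<lambda>y. f x y)"
  shows "sweedler sv f (class2 scale p) = free_extend sv (\<lambda>(x, y). f x y) p"
proof -
  interpret E: Vector_Spaces.linear free_scale sv "free_extend sv (\<lambda>(x, y). f x y)"
    by (rule free_extend_linear[OF sv])
  have "free_extend sv (\<lambda>(x, y). f x y) r = 0" if "r \<in> linearity_relations scale slots2" for r
  proof -
    interpret A: Vector_Spaces.linear scale sv "\<lambda>x. f x y" for y by (rule 1)
    interpret B: Vector_Spaces.linear scale sv "\<lambda>y. f x y" for x by (rule 2)
    from that show ?thesis
      by (auto simp: linearity_relations_def slots2_def E.diff E.scale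
          free_extend_point[OF sv] A.add B.add A.scale B.scale)
  qed
  then have "free_extend sv (\<lambda>(x, y). f x y) (representative (class2 scale p) - p) = 0"
    using E.eq_0_on_span[OF _ representative_class2] by blast
  then show ?thesis by (simp add: E.diff sweedler_def)
qed

end

theory Submission
  imports Defs
begin

text \<open>
  Comultiplicativity at \<open>1 a = a = a 1\<close> gives \<open>\<epsilon>\<^sub>L\<^sub>R * id = id = id * \<epsilon>\<^sub>R\<^sub>L\<close> in the
  convolution algebra. Part (i) is then a computation in this associative algebra:
  \<open>S = S * \<epsilon>\<^sub>L\<^sub>R = S * id * S' = \<epsilon>\<^sub>R\<^sub>L * S' = S'\<close>, and \<open>\<epsilon>\<^sub>L\<^sub>R * \<epsilon>\<^sub>L\<^sub>R = \<epsilon>\<^sub>L\<^sub>R * id * S\<^sub>p = \<epsilon>\<^sub>L\<^sub>R\<close>.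
  For part (ii), \<open>S(x) = S(x) S(1)\<close> turns \<open>1 = 1\<^sub>1 S(1\<^sub>2)\<close> into \<open>1 = S(1)\<close>. Dually,
  \<open>S(a) = S(a\<^sub>1) \<epsilon>(S(a\<^sub>2))\<close> gives \<open>\<epsilon>\<^sub>L\<^sub>R(a) = \<epsilon>\<^sub>L\<^sub>R(a\<^sub>1) \<epsilon>(S(a\<^sub>2))\<close>, to which one applies \<open>\<epsilon>\<close>,
  using \<open>\<epsilon> \<circ> \<epsilon>\<^sub>L\<^sub>R = \<epsilon>\<close>.
\<close>

section \<open>Evaluating Sweedler sums\<close>

lemma linear_free_extend:
  assumes "Vector_Spaces.linear sv sw h"
  shows "h (free_extend sv f p) = free_extend sw (\<lambda>x. h (f x)) p"
proof -
  interpret H: Vector_Spaces.linear sv sw h by fact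
  show ?thesis by (simp add: free_extend_def H.sum H.scale)
qed

lemma linear_sweedler:
  assumes "Vector_Spaces.linear sv sw h"
  shows "h (sweedler sv f t) = sweedler sw (\<lambda>x y. h (f x y)) t"
  by (simp add: sweedler_def linear_free_extend[OF assms] case_prod_unfold)

text \<open>Neither tensor depends on the indices of the other, so once the representatives are
  chosen this is an exchange of two finite sums.\<close>

lemma sweedler_swap:
  assumes "vector_space sv"
  shows "sweedler sv (\<lambda>x y. sweedler sv (f x y) t) s = sweedler sv (\<lambda>u v. sweedler sv (\<lambda>x y. f x y u v) s) t"
proof -
  interpret V: vector_space sv by fact
  show ?thesis
    unfolding sweedler_def free_extend_def case_prod_unfold V.scale_sum_right
    by (subst sum.swap) (simp add: mult.commute)
qed

text \<open>The representative of \<open>t\<close> stays fixed as \<open>z\<close> varies, so the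
  value is a fixed linear combination of the maps \<open>\<lambda>z. f z x y\<close>.\<close>

lemma linear_sweedler_parameter:
  assumes "vector_space scale" "vector_space sv"
    and "\<And>x y. Vector_Spaces.linear scale sv (\<lambda>z. f z x y)"
  shows "Vector_Spaces.linear scale sv (\<lambda>z. sweedler sv (f z) t)"
proof -
  interpret V: vector_space sv by fact
  have "f (u + v) x y = f u x y + f v x y" "f (scale c u) x y = sv c (f u x y)" for u v x y c
    using assms(3)[of x y] by (auto simp: Vector_Spaces.linear_iff)
  then show ?thesis
    using assms(1,2)
    by (simp add: Vector_Spaces.linear_iff sweedler_def free_extend_def case_prod_unfold
        V.scale_right_distrib sum.distrib V.scale_sum_right mult.commute)
qed

text \<open>Serves to evaluate bilinear maps on tensors that are themselves given by Sweedler sums: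
  products in the tensor square, and \<open>\<Delta> (S a)\<close> for anti-comultiplicative
  \<open>S\<close>.\<close>

lemma sweedler_class2_sweedler:
  assumes "vector_space sv"
    and "\<And>y. Vector_Spaces.linear scale sv (\<lambda>x. f x y)"
    and "\<And>x. Vector_Spaces.linear scale sv (\<lambda>y. f x y)"
  shows "sweedler sv f (class2 scale (sweedler free_scale g t)) =
    sweedler sv (\<lambda>x y. free_extend sv (\<lambda>(x, y). f x y) (g x y)) t"
  by (simp add: sweedler_class2[OF assms] linear_sweedler[OF free_extend_linear[OF assms(1)]])

lemma sweedler_tensor2_mult:
  assumes "vector_space sv"
    and "\<And>y. Vector_Spaces.linear scale sv (\<lambda>x. f x y)"
    and "\<And>x. Vector_Spaces.linear scale sv (\<lambda>y. f x y)"
  shows "sweedler sv f (tensor2_mult scale s t) =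
    sweedler sv (\<lambda>x y. sweedler sv (\<lambda>x' y'. f (x * x') (y * y')) t) s"
  by (simp add: tensor2_mult_def sweedler_class2_sweedler[OF assms] free_extend_point[OF assms(1)]
      linear_sweedler[OF free_extend_linear[OF assms(1)]])

text \<open>The linear extension of a trilinear map kills the linearity relations of all three
  slots, so it descends to the threefold tensor power.\<close>

lemma free_extend_class3_cong:
  fixes scale :: "'k::field \<Rightarrow> 'a::ab_group_add \<Rightarrow> 'a"
    and sv :: "'k \<Rightarrow> 'v::ab_group_add \<Rightarrow> 'v"
  assumes sv: "vector_space sv"
    and 1: "\<And>y z. Vector_Spaces.linear scale sv (\<lambda>x. f x y z)"
    and 2: "\<And>x z. Vector_Spaces.linear scale sv (\<lambda>y. f x y z)"
    and 3: "\<And>x y. Vector_Spaces.linear scale sv (\<lambda>z. f x y z)"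
    and eq: "class3 scale p = class3 scale q"
  shows "free_extend sv (\<lambda>(x, y, z). f x y z) p = free_extend sv (\<lambda>(x, y, z). f x y z) q"
proof -
  interpret E: Vector_Spaces.linear free_scale sv "free_extend sv (\<lambda>(x, y, z). f x y z)"
    by (rule free_extend_linear[OF sv])
  have "free_extend sv (\<lambda>(x, y, z). f x y z) r = 0" if "r \<in> linearity_relations scale slots3" for r
  proof -
    interpret A: Vector_Spaces.linear scale sv "\<lambda>x. f x y z" for y z by (rule 1)
    interpret B: Vector_Spaces.linear scale sv "\<lambda>y. f x y z" for x z by (rule 2)
    interpret C: Vector_Spaces.linear scale sv "\<lambda>z. f x y z" for x y by (rule 3)
    from that show ?thesis
      by (auto simp: linearity_relations_def slots3_def E.diff E.scale
          free_extend_point[OF sv] A.add B.add C.add A.scale B.scale C.scale)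
  qed
  moreover have "p - q \<in> module.span free_scale (linearity_relations scale slots3)"
    using eq by (simp add: class3_def tensor_class_eq_iff)
  ultimately have "free_extend sv (\<lambda>(x, y, z). f x y z) (p - q) = 0"
    using E.eq_0_on_span by blast
  then show ?thesis by (simp add: E.diff)
qed

section \<open>Coassociativity in Sweedler form\<close>

context coalgebra
begin

lemma sweedler_coassoc:
  assumes sv: "vector_space sv"
    and "\<And>y z. Vector_Spaces.linear scale sv (\<lambda>x. f x y z)"
    and "\<And>x z. Vector_Spaces.linear scale sv (\<lambda>y. f x y z)"
    and "\<And>x y. Vector_Spaces.linear scale sv (\<lambda>z. f x y z)"
  shows "sweedler sv (\<lambda>x y. sweedler sv (\<lambda>u v. f u v y) (\<Delta> x)) (\<Delta> a) =
    sweedler sv (\<lambda>x y. sweedler sv (\<lambda>u v. f x u v) (\<Delta> y)) (\<Delta> a)"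
  using free_extend_class3_cong[OF assms coassoc[of a]]
  by (simp add: linear_sweedler[OF free_extend_linear[OF sv]] free_extend_point[OF sv])

text \<open>The chosen representative of \<open>\<Delta> a\<close> need not vary linearly with
  \<open>a\<close>. Bilinearity of \<open>f\<close> makes the value depend only on the class, and
  the class does vary linearly.\<close>

lemma linear_sweedler_comult:
  assumes sv: "vector_space sv"
    and "\<And>y. Vector_Spaces.linear scale sv (\<lambda>x. f x y)"
    and "\<And>x. Vector_Spaces.linear scale sv (\<lambda>y. f x y)"
  shows "Vector_Spaces.linear scale sv (\<lambda>a. sweedler sv f (\<Delta> a))"
proof -
  interpret E: Vector_Spaces.linear free_scale sv "free_extend sv (\<lambda>(x, y). f x y)"
    by (rule free_extend_linear[OF sv])
  show ?thesis
    using vector_space sv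
    by (simp add: Vector_Spaces.linear_iff comult_add comult_scale tensor2_add_def
        tensor2_scale_def sweedler_class2[OF assms] E.add E.scale) (simp add: sweedler_def)
qed

lemma counit_add: "\<epsilon> (a + b) = \<epsilon> a + \<epsilon> b"
  and counit_scale: "\<epsilon> (scale c a) = c * \<epsilon> a"
  using counit_linear by (auto simp: Vector_Spaces.linear_iff)

end

section \<open>The convolution algebra\<close>

context weak_bialgebra
begin

interpretation V: vector_space scale by (rule vector_space)

lemma linear_mult_left: "Vector_Spaces.linear scale scale ((*) a)"
  by (simp add: Vector_Spaces.linear_iff vector_space distrib_left scale_mult_right)

lemma linear_mult_right: "Vector_Spaces.linear scale scale (\<lambda>x. x * a)"
  by (simp add: Vector_Spaces.linear_iff vector_space distrib_right scale_mult_left)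

lemma linear_eps_LR: "Vector_Spaces.linear scale scale (eps_LR scale \<Delta> \<epsilon>)"
  unfolding eps_LR_def
  by (intro linear_sweedler_parameter vector_space)
    (simp add: Vector_Spaces.linear_iff vector_space distrib_left scale_mult_right counit_add
      counit_scale V.scale_left_distrib)

lemma linear_eps_RL: "Vector_Spaces.linear scale scale (eps_RL scale \<Delta> \<epsilon>)"
  unfolding eps_RL_def
  by (intro linear_sweedler_parameter vector_space)
    (simp add: Vector_Spaces.linear_iff vector_space distrib_right scale_mult_left counit_add
      counit_scale V.scale_left_distrib)

lemma linear_convolution:
  assumes "Vector_Spaces.linear scale scale S" "Vector_Spaces.linear scale scale T"
  shows "Vector_Spaces.linear scale scale (convolution scale \<Delta> S T)"
  unfolding convolution_def
  by (intro linear_sweedler_comult vector_space)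
    (use assms in \<open>simp_all add: Vector_Spaces.linear_iff distrib_left distrib_right
      scale_mult_left scale_mult_right\<close>)

text \<open>Both sides evaluate the trilinear map \<open>S x * T y * U z\<close> on the iterated
  coproduct of \<open>a\<close>, bracketed in the two ways that coassociativity identifies.\<close>

lemma convolution_assoc:
  assumes "Vector_Spaces.linear scale scale S" "Vector_Spaces.linear scale scale T"
    "Vector_Spaces.linear scale scale U"
  shows "convolution scale \<Delta> (convolution scale \<Delta> S T) U =
    convolution scale \<Delta> S (convolution scale \<Delta> T U)"
proof
  fix a
  have "sweedler scale (\<lambda>x y. sweedler scale (\<lambda>u v. S u * T v * U y) (\<Delta> x)) (\<Delta> a) =
      sweedler scale (\<lambda>x y. sweedler scale (\<lambda>u v. S x * T u * U v) (\<Delta> y)) (\<Delta> a)"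
    by (intro sweedler_coassoc vector_space)
      (use assms in \<open>simp_all add: Vector_Spaces.linear_iff distrib_left distrib_right
        scale_mult_left scale_mult_right\<close>)
  then show "convolution scale \<Delta> (convolution scale \<Delta> S T) U a =
      convolution scale \<Delta> S (convolution scale \<Delta> T U) a"
    by (simp add: convolution_def linear_sweedler[OF linear_mult_left]
        linear_sweedler[OF linear_mult_right] mult.assoc)
qed

lemma convolution_eps_LR_id: "convolution scale \<Delta> (eps_LR scale \<Delta> \<epsilon>) id = id"
proof
  fix a
  have "convolution scale \<Delta> (eps_LR scale \<Delta> \<epsilon>) id a =
      sweedler scale (\<lambda>x y. sweedler scale (\<lambda>u v. scale (\<epsilon> (u * x)) (v * y)) (\<Delta> 1)) (\<Delta> a)"
    by (simp add: convolution_def eps_LR_def linear_sweedler[OF linear_mult_right] scale_mult_left)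
  \<comment> \<open>The outer sum must run over the left factor of \<Delta>(1)\<Delta>(a) to match
    \<open>sweedler_tensor2_mult\<close>.\<close>
  also have "\<dots> = sweedler scale (\<lambda>u v. sweedler scale (\<lambda>x y. scale (\<epsilon> (u * x)) (v * y)) (\<Delta> a)) (\<Delta> 1)"
    by (rule sweedler_swap[OF vector_space])
  also have "\<dots> = sweedler scale (\<lambda>x y. scale (\<epsilon> x) y) (tensor2_mult scale (\<Delta> 1) (\<Delta> a))"
    by (rule sweedler_tensor2_mult[OF vector_space, symmetric])
      (simp_all add: Vector_Spaces.linear_iff vector_space counit_add counit_scale
        V.scale_left_distrib V.scale_right_distrib mult.commute)
  also have "\<dots> = a"
    by (simp add: comult_mult[symmetric] counit_left)
  finally show "convolution scale \<Delta> (eps_LR scale \<Delta> \<epsilon>) id a = id a" by simp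
qed

lemma convolution_id_eps_RL: "convolution scale \<Delta> id (eps_RL scale \<Delta> \<epsilon>) = id"
proof
  fix a
  have "convolution scale \<Delta> id (eps_RL scale \<Delta> \<epsilon>) a =
      sweedler scale (\<lambda>x y. sweedler scale (\<lambda>u v. scale (\<epsilon> (y * v)) (x * u)) (\<Delta> 1)) (\<Delta> a)"
    by (simp add: convolution_def eps_RL_def linear_sweedler[OF linear_mult_left] scale_mult_right)
  also have "\<dots> = sweedler scale (\<lambda>x y. scale (\<epsilon> y) x) (tensor2_mult scale (\<Delta> a) (\<Delta> 1))"
    by (rule sweedler_tensor2_mult[OF vector_space, symmetric])
      (simp_all add: Vector_Spaces.linear_iff vector_space counit_add counit_scale
        V.scale_left_distrib V.scale_right_distrib mult.commute)
  also have "\<dots> = a"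
    by (simp add: comult_mult[symmetric] counit_right)
  finally show "convolution scale \<Delta> id (eps_RL scale \<Delta> \<epsilon>) a = id a" by simp
qed

lemma pre_antipode_iff:
  "pre_antipode scale \<Delta> \<epsilon> S \<longleftrightarrow> Vector_Spaces.linear scale scale S \<and>
    convolution scale \<Delta> id S = eps_LR scale \<Delta> \<epsilon> \<and> convolution scale \<Delta> S id = eps_RL scale \<Delta> \<epsilon>"
  by (auto simp: pre_antipode_def convolution_def fun_eq_iff)

text \<open>Indices taken from (\<Delta> \<otimes> id)\<Delta>(a) correspond to the left bracketing
  of the triple convolution.\<close>

lemma antipode_iff:
  "antipode scale \<Delta> \<epsilon> S \<longleftrightarrow>
    pre_antipode scale \<Delta> \<epsilon> S \<and> convolution scale \<Delta> (convolution scale \<Delta> S id) S = S"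
  by (simp add: antipode_def convolution_def fun_eq_iff linear_sweedler[OF linear_mult_right])

section \<open>Uniqueness and construction of antipodes\<close>

lemma antipode_unique:
  assumes "antipode scale \<Delta> \<epsilon> S" "antipode scale \<Delta> \<epsilon> S'"
  shows "S = S'"
  \<comment> \<open>The first instance yields \<open>S = S * eps_LR\<close>. After
    \<open>eps_LR\<close> is written as \<open>id * S'\<close>, the second moves the bracket to give
    \<open>eps_RL * S' = S'\<close>.\<close>
  using assms convolution_assoc[OF _ V.linear_id, of S S] convolution_assoc[OF _ V.linear_id, of S S']
  unfolding antipode_iff pre_antipode_iff by metis

lemma convolution_eps_LR_eps_LR:
  assumes "pre_antipode scale \<Delta> \<epsilon> S"
  shows "convolution scale \<Delta> (eps_LR scale \<Delta> \<epsilon>) (eps_LR scale \<Delta> \<epsilon>) = eps_LR scale \<Delta> \<epsilon>"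
  using assms convolution_assoc[OF linear_eps_LR V.linear_id, of S]
  by (simp add: pre_antipode_iff convolution_eps_LR_id)

text \<open>Mirror image of the previous argument:
  \<open>eps_RL * eps_RL = S * (id * eps_RL) = S * id = eps_RL\<close>.\<close>

lemma convolution_eps_RL_eps_RL:
  assumes "pre_antipode scale \<Delta> \<epsilon> S"
  shows "convolution scale \<Delta> (eps_RL scale \<Delta> \<epsilon>) (eps_RL scale \<Delta> \<epsilon>) = eps_RL scale \<Delta> \<epsilon>"
  using assms convolution_assoc[OF _ V.linear_id linear_eps_RL, of S]
  by (simp add: pre_antipode_iff convolution_id_eps_RL)

text \<open>The candidate is \<open>eps_RL * P\<close>. The right unit law
  \<open>id * eps_RL = id\<close> gives the first pre-antipode equation; idempotence of
  \<open>eps_RL\<close> gives the second and the antipode equation.\<close>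

lemma antipode_convolution:
  assumes pre: "pre_antipode scale \<Delta> \<epsilon> P"
  shows "antipode scale \<Delta> \<epsilon> (convolution scale \<Delta> (convolution scale \<Delta> P id) P)"
proof -
  let ?L = "eps_LR scale \<Delta> \<epsilon>" and ?R = "eps_RL scale \<Delta> \<epsilon>"
  define S where "S = convolution scale \<Delta> ?R P"
  have P: "Vector_Spaces.linear scale scale P" "convolution scale \<Delta> id P = ?L"
      "convolution scale \<Delta> P id = ?R"
    using pre by (auto simp: pre_antipode_iff)
  have "convolution scale \<Delta> id S = ?L"
    using convolution_assoc[OF V.linear_id linear_eps_RL P(1)]
    by (simp add: S_def convolution_id_eps_RL P)
  moreover have "convolution scale \<Delta> S id = ?R"
    using convolution_assoc[OF linear_eps_RL P(1) V.linear_id]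
    by (simp add: S_def convolution_eps_RL_eps_RL[OF pre] P)
  moreover have "convolution scale \<Delta> ?R S = S"
    using convolution_assoc[OF linear_eps_RL linear_eps_RL P(1)]
    by (simp add: S_def convolution_eps_RL_eps_RL[OF pre])
  moreover have "Vector_Spaces.linear scale scale S"
    unfolding S_def by (intro linear_convolution linear_eps_RL P)
  ultimately show ?thesis by (simp add: antipode_iff pre_antipode_iff P flip: S_def)
qed

section \<open>Compatibility with unit and counit\<close>

lemma anti_multiplicative_one:
  assumes "pre_antipode scale \<Delta> \<epsilon> S" "anti_multiplicative S"
  shows "S 1 = 1"
proof -
  have S: "S x * S 1 = S x" "S 1 * S x = S x" for x
    using assms(2) by (metis anti_multiplicative_def mult_1_left mult_1_right)+
  \<comment> \<open>At the unit, \<open>eps_LR\<close> reduces to the left counit law, so its value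
    there is 1.\<close>
  have "1 = sweedler scale (\<lambda>x y. x * S y) (\<Delta> 1)"
    using assms(1) counit_left[of 1] by (simp add: pre_antipode_def eps_LR_def)
  moreover have "sweedler scale (\<lambda>x y. x * S y) (\<Delta> 1) * S 1 = sweedler scale (\<lambda>x y. x * S y) (\<Delta> 1)"
    by (simp add: linear_sweedler[OF linear_mult_right] mult.assoc S)
  ultimately show ?thesis by (metis mult_1_left)
qed

text \<open>By linearity \<epsilon>(1_1 a) \<epsilon>(1_2) equals \<epsilon>((1_1 \<epsilon>(1_2))
  a), and the right counit law collapses the inner sum to 1.\<close>

lemma counit_eps_LR: "\<epsilon> (eps_LR scale \<Delta> \<epsilon> a) = \<epsilon> a"
proof -
  have "\<epsilon> (eps_LR scale \<Delta> \<epsilon> a) = sweedler (*) (\<lambda>x y. \<epsilon> (scale (\<epsilon> y) x * a)) (\<Delta> 1)"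
    by (simp add: eps_LR_def linear_sweedler[OF counit_linear] counit_scale scale_mult_left mult.commute)
  also have "\<dots> = \<epsilon> (sweedler scale (\<lambda>x y. scale (\<epsilon> y) x) (\<Delta> 1) * a)"
    by (simp add: linear_sweedler[OF linear_mult_right] linear_sweedler[OF counit_linear])
  finally show ?thesis by (simp add: counit_right)
qed

lemma anti_comultiplicative_counit:
  assumes pre: "pre_antipode scale \<Delta> \<epsilon> S" and anti: "anti_comultiplicative scale \<Delta> S"
  shows "\<epsilon> (S a) = \<epsilon> a"
proof -
  let ?L = "eps_LR scale \<Delta> \<epsilon>"
  have lin: "Vector_Spaces.linear scale scale S" and L: "sweedler scale (\<lambda>x y. x * S y) (\<Delta> b) = ?L b" for b
    using pre by (auto simp: pre_antipode_def)
  have S: "S (x + y) = S x + S y" "S (scale c x) = scale c (S x)" for x y c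
    using lin by (auto simp: Vector_Spaces.linear_iff)
  \<comment> \<open>The left counit law at \<open>S y\<close>: the flip in \<Delta>(S(y)) = S(y_2)
    \<otimes> S(y_1) places the counit on S(y_2).\<close>
  have Delta: "S y = sweedler scale (\<lambda>u v. scale (\<epsilon> (S v)) (S u)) (\<Delta> y)" for y
  proof -
    have "S y = sweedler scale (\<lambda>x y. scale (\<epsilon> x) y)
        (class2 scale (sweedler free_scale (\<lambda>x y. point (S y, S x)) (\<Delta> y)))"
      using anti counit_left[of "S y"] by (simp add: anti_comultiplicative_def)
    also have "\<dots> = sweedler scale (\<lambda>u v. scale (\<epsilon> (S v)) (S u)) (\<Delta> y)"
      by (subst sweedler_class2_sweedler[OF vector_space])
        (simp_all add: Vector_Spaces.linear_iff vector_space counit_add counit_scale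
          V.scale_left_distrib V.scale_right_distrib mult.commute free_extend_point)
    finally show ?thesis .
  qed
  \<comment> \<open>The expansion is inserted into a_1 S(a_2), so that coassociativity can regroup
    the first two of the three indices into \<open>eps_LR\<close>.\<close>
  have "?L a = sweedler scale (\<lambda>x y. x * sweedler scale (\<lambda>u v. scale (\<epsilon> (S v)) (S u)) (\<Delta> y)) (\<Delta> a)"
    by (simp only: L[symmetric] Delta[symmetric])
  also have "\<dots> = sweedler scale (\<lambda>x y. sweedler scale (\<lambda>u v. scale (\<epsilon> (S v)) (x * S u)) (\<Delta> y)) (\<Delta> a)"
    by (simp add: linear_sweedler[OF linear_mult_left] scale_mult_right)
  also have "\<dots> = sweedler scale (\<lambda>x y. sweedler scale (\<lambda>u v. scale (\<epsilon> (S y)) (u * S v)) (\<Delta> x)) (\<Delta> a)"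
    by (rule sweedler_coassoc[OF vector_space, symmetric])
      (simp_all add: Vector_Spaces.linear_iff vector_space counit_add counit_scale S
        V.scale_left_distrib V.scale_right_distrib mult.commute distrib_left distrib_right
        scale_mult_left scale_mult_right)
  also have "\<dots> = sweedler scale (\<lambda>x y. scale (\<epsilon> (S y)) (?L x)) (\<Delta> a)"
    by (simp only: L[symmetric] linear_sweedler[OF V.linear_scale_self])
  \<comment> \<open>Here \<epsilon>(\<open>?L x\<close>) becomes \<epsilon>(x), a scalar that is
    then moved inside \<open>S\<close> so that the left counit law applies to its argument.\<close>
  finally have "\<epsilon> (?L a) = sweedler (*) (\<lambda>x y. \<epsilon> (S (scale (\<epsilon> x) y))) (\<Delta> a)"
    by (simp add: linear_sweedler[OF counit_linear] counit_scale counit_eps_LR S mult.commute)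
  also have "\<dots> = \<epsilon> (S (sweedler scale (\<lambda>x y. scale (\<epsilon> x) y) (\<Delta> a)))"
    by (simp only: linear_sweedler[OF lin] linear_sweedler[OF counit_linear])
  finally show ?thesis by (simp add: counit_left counit_eps_LR)
qed

end

theorem lemma7p3:
  fixes scale :: "'k::field \<Rightarrow> 'a::{ring, monoid_mult} \<Rightarrow> 'a"
    and \<Delta> :: "'a \<Rightarrow> ('a, 'k) tensor2"
    and \<epsilon> :: "'a \<Rightarrow> 'k"
  assumes "weak_bialgebra scale \<Delta> \<epsilon>"
  shows "(\<forall>S S'. antipode scale \<Delta> \<epsilon> S \<longrightarrow> antipode scale \<Delta> \<epsilon> S' \<longrightarrow> S = S') \<and>
    (\<forall>S\<^sub>p. pre_antipode scale \<Delta> \<epsilon> S\<^sub>p \<longrightarrow>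
       convolution scale \<Delta> (eps_LR scale \<Delta> \<epsilon>) (eps_LR scale \<Delta> \<epsilon>) = eps_LR scale \<Delta> \<epsilon> \<and>
       convolution scale \<Delta> (eps_RL scale \<Delta> \<epsilon>) (eps_RL scale \<Delta> \<epsilon>) = eps_RL scale \<Delta> \<epsilon> \<and>
       antipode scale \<Delta> \<epsilon> (convolution scale \<Delta> (convolution scale \<Delta> S\<^sub>p id) S\<^sub>p)) \<and>
    (\<forall>S. pre_antipode scale \<Delta> \<epsilon> S \<longrightarrow>
       (anti_multiplicative S \<longrightarrow> S 1 = 1) \<and>
       (anti_comultiplicative scale \<Delta> S \<longrightarrow> \<epsilon> \<circ> S = \<epsilon>))"
proof -
  interpret weak_bialgebra scale \<Delta> \<epsilon> by fact
  show ?thesis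
    using antipode_unique convolution_eps_LR_eps_LR convolution_eps_RL_eps_RL
      antipode_convolution anti_multiplicative_one anti_comultiplicative_counit
    by (simp add: fun_eq_iff)
qed

end
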